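(* Let $f,g,r\in\mathbb{F}[x]$ with $f\ne0$, $\deg g\ge1$ and $g=rf$. Regard $A_g\subseteq A_f$ via the embedding $x\mapsto x$, $\tilde y\mapsto yr$, where $A_f$ is generated by $x,y$ with $yx-xy=f$ and $A_g$ by $x,\tilde y$ with $\tilde yx-x\tilde y=g$. (i) Let $\omega\in\mathrm{Aut}_{\mathbb{F}}(A_g)$ be given by $\omega(x)=\alpha x+\beta$ and $\omega(\tilde y)=\alpha^{\deg g-1}(\tilde y+q(x))$, where $\alpha\in\mathbb{F}^*$, $\beta\in\mathbb{F}$, $q\in\mathbb{F}[x]$ and $g(\alpha x+\beta)=\alpha^{\deg g}g(x)$ (every automorphism of $A_g$ has this form). Then $\omega$ extends to an automorphism of $A_f$ if and only if $f(\alpha x+\beta)=\alpha^{\deg f}f(x)$ and $r$ divides $q$. (ii) Let $\psi\in\mathrm{Aut}_{\mathbb{F}}(A_f)$. Then $\psi(A_g)=A_g$ (so $\psi$ restricts to an automorphism of $A_g$) if and only if $\psi(g)=\lambda g$ for some $\lambda\in\mathbb{F}^*$.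
   Context: $\mathbb{F}$ is an arbitrary field. For $h\in\mathbb{F}[x]$, $A_h$ is the unital associative $\mathbb{F}$-algebra generated by two elements $x$ and a second generator with commutator (second generator)$\cdot x - x\cdot$(second generator)$=h$. If $g=rf$, then $[yr,x]=g$ in $A_f$, so $x\mapsto x$, $\tilde y\mapsto yr$ defines an injective homomorphism $A_g\to A_f$. *)

theory Defs
  imports "HOL-Computational_Algebra.Polynomial"
begin

text \<open>Concrete model of the algebra A_h = F<x,y | yx - xy = h> as the Ore extension
  F[x][y; delta] with delta = h * d/dx.  An element is written uniquely as
  sum_i p_i(x) y^i (PBW basis x^a y^b) and is represented by the polynomial
  in y with coefficients p_i in F[x], i.e. by an element of type 'a poly poly.
  Addition and F-scalar multiplication are the ones of 'a poly poly; the
  noncommutative product is wmul h below.\<close>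

definition wdelta :: "'a::field poly \<Rightarrow> 'a poly \<Rightarrow> 'a poly" where
  "wdelta h p = h * pderiv p"

definition wmul :: "'a::field poly \<Rightarrow> 'a poly poly \<Rightarrow> 'a poly poly \<Rightarrow> 'a poly poly" where
  "wmul h a b = (\<Sum>i\<le>degree a. \<Sum>j\<le>degree b. \<Sum>k\<le>i.
      monom (coeff a i * of_nat (i choose k) * (wdelta h ^^ k) (coeff b j)) (i - k + j))"

primrec wpow :: "'a::field poly \<Rightarrow> 'a poly poly \<Rightarrow> nat \<Rightarrow> 'a poly poly" where
  "wpow h a 0 = 1"
| "wpow h a (Suc n) = wmul h a (wpow h a n)"

definition genX :: "'a::field poly poly" where
  "genX = [:[:0, 1:]:]"

definition genY :: "'a::field poly poly" where
  "genY = monom 1 1"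

definition is_aut :: "'a::field poly \<Rightarrow> ('a poly poly \<Rightarrow> 'a poly poly) \<Rightarrow> bool" where
  "is_aut h \<phi> \<longleftrightarrow> bij \<phi>
     \<and> (\<forall>a b. \<phi> (a + b) = \<phi> a + \<phi> b)
     \<and> (\<forall>c a. \<phi> (smult [:c:] a) = smult [:c:] (\<phi> a))
     \<and> (\<forall>a b. \<phi> (wmul h a b) = wmul h (\<phi> a) (\<phi> b))
     \<and> \<phi> 1 = 1"

text \<open>The embedding A_g \<rightarrow> A_f (g = r f): x \<mapsto> x, y~ \<mapsto> y r,
  i.e. sum_i p_i(x) y~^i \<mapsto> sum_i p_i(x) (y r)^i computed in A_f.\<close>
definition emb :: "'a::field poly \<Rightarrow> 'a poly \<Rightarrow> 'a poly poly \<Rightarrow> 'a poly poly" where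
  "emb f r a = (\<Sum>i\<le>degree a. wmul f [:coeff a i:] (wpow f (wmul f genY [:r:]) i))"

end

theory Submission
  imports Defs
begin

text \<open>Every \<open>A\<^sub>h\<close> is a domain in which the \<open>y\<close>-degree is additive, and a homomorphism out of it is
  determined by the images of \<open>x\<close> and \<open>y\<close>.

  (i) If \<open>\<phi>\<close> extends \<open>\<omega>\<close>, comparing coefficients in \<open>\<phi>(y) r(\<alpha>x+\<beta>) = \<alpha>\<^bsup>deg g - 1\<^esup> (y r + q)\<close> shows that
  \<open>\<phi>(y) = e y + b\<close> with \<open>e\<close> a scalar, that \<open>r(\<alpha>x+\<beta>)\<close> is a scalar multiple of \<open>r\<close>, and that \<open>r\<close> divides
  \<open>q\<close>.  Conversely \<open>y \<mapsto> \<alpha>\<^bsup>deg f - 1\<^esup> (y + q/r)\<close> works.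

  (ii) The elements \<open>\<psi>(g)\<close> and \<open>\<psi>\<^sup>-\<^sup>1(g)\<close> are commutators of elements of \<open>A\<^sub>g\<close>, hence lie in \<open>g A\<^sub>g\<close>, so
  \<open>\<psi>(g)\<close> is \<open>g\<close> times a unit, and units are scalars.  Conversely, if \<open>\<psi>(g) = g(\<psi>(x))\<close> is a multiple of \<open>g\<close>,
  then it has \<open>y\<close>-degree \<open>0\<close>, which forces \<open>\<psi>(x) = \<alpha>x+\<beta>\<close>; surjectivity then forces \<open>\<psi>(y) = e y + b\<close>
  with \<open>e\<close> a scalar.  So \<open>f\<close>, and with it \<open>r\<close>, is semi-invariant, and \<open>\<psi>(y r)\<close> lies in \<open>A\<^sub>g\<close>.  This avoids
  centralizers and is valid in every characteristic.\<close>

section \<open>Left multiplication by \<open>y\<close> as an operator\<close>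

lemma wdelta_simps [simp]:
  "wdelta h 0 = 0" "wdelta h 1 = 0" "wdelta h (p + q) = wdelta h p + wdelta h q"
  by (simp_all add: wdelta_def pderiv_add algebra_simps)

lemma wdelta_mult: "wdelta h (p * q) = p * wdelta h q + wdelta h p * q"
  by (simp add: wdelta_def pderiv_mult algebra_simps)

text \<open>Left multiplication by \<open>y\<close> in \<open>A\<^sub>h\<close>: \<open>y p = p y + \<delta>(p)\<close> coefficientwise.  The closed
  formula for the product amounts to \<open>a b = \<Sum>\<^sub>i a\<^sub>i (lmulY h)\<^sup>i b\<close>, which replaces all binomial
  bookkeeping by recursion on \<open>a\<close>.\<close>

definition lmulY :: "'a::field poly \<Rightarrow> 'a poly poly \<Rightarrow> 'a poly poly" where
  "lmulY h b = pCons 0 b + map_poly (wdelta h) b"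

lemma coeff_lmulY: "coeff (lmulY h b) n = coeff (pCons 0 b) n + wdelta h (coeff b n)"
  by (simp add: lmulY_def coeff_map_poly)

lemma lmulY_0 [simp]: "lmulY h 0 = 0"
  by (simp add: lmulY_def)

lemma lmulY_add: "lmulY h (a + b) = lmulY h a + lmulY h b"
  by (rule poly_eqI) (simp add: coeff_lmulY coeff_pCons split: nat.splits)

lemma lmulY_sum: "lmulY h (\<Sum>i\<in>A. f i) = (\<Sum>i\<in>A. lmulY h (f i))"
  by (induction A rule: infinite_finite_induct) (simp_all add: lmulY_add)

lemma lmulY_smult: "lmulY h (smult p b) = smult p (lmulY h b) + smult (wdelta h p) b"
  by (rule poly_eqI)
    (simp add: coeff_lmulY coeff_pCons wdelta_mult algebra_simps split: nat.splits)

lemma lmulY_pCons: "lmulY h (pCons p b) = pCons (wdelta h p) ([:p:] + lmulY h b)"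
  by (rule poly_eqI) (simp add: coeff_lmulY coeff_pCons split: nat.splits)

lemma lmulY_monom: "lmulY h (monom p j) = monom p (Suc j) + monom (wdelta h p) j"
  by (rule poly_eqI) (simp add: coeff_lmulY coeff_pCons split: nat.splits)

text \<open>The first summand is the commutative product with \<open>y\<close>, so noncommutativity
  is confined to a multiple of \<open>h\<close>; \<open>wmul_eq_mult_mod\<close> builds on
  this.\<close>

lemma lmulY_eq_mult: "lmulY h b = monom 1 1 * b + smult h (map_poly pderiv b)"
  by (rule poly_eqI)
    (simp add: coeff_lmulY coeff_pCons coeff_map_poly coeff_monom_mult wdelta_def
      split: nat.splits)

text \<open>The derivation acts coefficientwise and cannot raise the \<open>y\<close>-degree, so the
  shift alone determines the top term.\<close>

lemma degree_lmulY:
  assumes "b \<noteq> 0"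
  shows "degree (lmulY h b) = Suc (degree b)" "lead_coeff (lmulY h b) = lead_coeff b"
proof -
  have c: "coeff (lmulY h b) (Suc (degree b)) = lead_coeff b"
    by (simp add: coeff_lmulY coeff_eq_0)
  have "degree (lmulY h b) \<le> Suc (degree b)"
    by (rule degree_le) (auto simp: coeff_lmulY coeff_pCons coeff_eq_0 split: nat.splits)
  moreover have "Suc (degree b) \<le> degree (lmulY h b)"
    by (rule le_degree) (use c assms in simp)
  ultimately show d: "degree (lmulY h b) = Suc (degree b)" by simp
  show "lead_coeff (lmulY h b) = lead_coeff b" using c d by simp
qed

section \<open>The closed product formula via iterated \<open>lmulY\<close>\<close>

lemma sum_binomial_Suc:
  fixes F :: "nat \<Rightarrow> 'b::comm_semiring_1"
  shows "(\<Sum>k\<le>Suc n. of_nat (Suc n choose k) * F k) =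
    (\<Sum>k\<le>n. of_nat (n choose k) * F k) + (\<Sum>k\<le>n. of_nat (n choose k) * F (Suc k))"
proof -
  have split: "(\<Sum>k\<le>Suc n. of_nat (Suc n choose k) * F k) =
      F 0 + (\<Sum>k\<le>n. of_nat (n choose Suc k) * F (Suc k))
          + (\<Sum>k\<le>n. of_nat (n choose k) * F (Suc k))"
    by (simp add: sum.atMost_Suc_shift algebra_simps sum.distrib del: sum.atMost_Suc)
  have "F 0 + (\<Sum>k\<le>n. of_nat (n choose Suc k) * F (Suc k)) =
      (\<Sum>k\<le>Suc n. of_nat (n choose k) * F k)"
    by (simp add: sum.atMost_Suc_shift del: sum.atMost_Suc)
  also have "\<dots> = (\<Sum>k\<le>n. of_nat (n choose k) * F k)"
    by (simp add: binomial_eq_0)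
  finally show ?thesis
    by (simp only: split)
qed

lemma monom_of_nat_mult: "monom (of_nat n * p) m = of_nat n * monom p m"
  by (metis of_nat_monom mult_monom add_0)

lemma lmulY_of_nat_mult: "lmulY h (of_nat n * b) = of_nat n * lmulY h b"
  by (induction n) (simp_all add: algebra_simps lmulY_add)

text \<open>The shift and the coefficientwise derivation commute, so powers of their sum expand
  binomially; Pascal's rule \<open>sum_binomial_Suc\<close> is the induction step.\<close>

lemma lmulY_funpow_monom:
  "(lmulY h ^^ i) (monom p j) =
    (\<Sum>k\<le>i. of_nat (i choose k) * monom ((wdelta h ^^ k) p) (i - k + j))"
proof (induction i)
  case 0
  show ?case by simp
next
  case (Suc i)
  have "(lmulY h ^^ Suc i) (monom p j) =
      (\<Sum>k\<le>i. of_nat (i choose k) * monom ((wdelta h ^^ k) p) (Suc (i - k + j)))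
    + (\<Sum>k\<le>i. of_nat (i choose k) * monom ((wdelta h ^^ Suc k) p) (i - k + j))"
    by (simp add: Suc lmulY_sum lmulY_of_nat_mult lmulY_monom distrib_left sum.distrib)
  also have "(\<Sum>k\<le>i. of_nat (i choose k) * monom ((wdelta h ^^ k) p) (Suc (i - k + j)))
     = (\<Sum>k\<le>i. of_nat (i choose k) * monom ((wdelta h ^^ k) p) (Suc i - k + j))"
    by (rule sum.cong) (auto simp: Suc_diff_le)
  finally show ?case
    using sum_binomial_Suc[of i "\<lambda>k. monom ((wdelta h ^^ k) p) (Suc i - k + j)"]
    by simp
qed

lemma lmulY_funpow_sum: "(lmulY h ^^ i) (\<Sum>j\<in>A. f j) = (\<Sum>j\<in>A. (lmulY h ^^ i) (f j))"
  by (induction i) (simp_all add: lmulY_sum)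

lemma smult_sum_right: "smult p (\<Sum>j\<in>A. f j) = (\<Sum>j\<in>A. smult p (f j))"
  by (induction A rule: infinite_finite_induct) (simp_all add: smult_add_right)

lemma smult_of_nat_mult_monom:
  "smult p (of_nat n * monom q m) = monom (p * of_nat n * q) m"
  by (simp add: monom_of_nat_mult[symmetric] smult_monom mult.assoc)

lemma wmul_eq_sum: "wmul h a b = (\<Sum>i\<le>degree a. smult (coeff a i) ((lmulY h ^^ i) b))"
proof -
  have "(lmulY h ^^ i) b = (\<Sum>j\<le>degree b. (lmulY h ^^ i) (monom (coeff b j) j))" for i
    using lmulY_funpow_sum[of i h "\<lambda>j. monom (coeff b j) j" "{..degree b}"]
    by (simp add: poly_as_sum_of_monoms)
  then show ?thesis
    unfolding wmul_def
    by (simp add: lmulY_funpow_monom smult_sum_right smult_of_nat_mult_monom)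
qed

section \<open>Ring laws for \<open>wmul\<close>\<close>

lemma wmul_0_left [simp]: "wmul h 0 b = 0"
  by (simp add: wmul_eq_sum)

text \<open>Reads the left factor as \<open>p + a y\<close> and moves \<open>y\<close> onto the
  right factor; the later inductions on the left factor rest on this recursion.\<close>

lemma wmul_pCons: "wmul h (pCons p a) b = smult p b + wmul h a (lmulY h b)"
proof (cases "a = 0")
  case True
  then show ?thesis by (simp add: wmul_eq_sum)
next
  case False
  then show ?thesis
    by (simp add: wmul_eq_sum sum.atMost_Suc_shift funpow_swap1 del: sum.atMost_Suc)
qed

lemma wmul_0_right [simp]: "wmul h a 0 = 0"
  by (induction a) (simp_all add: wmul_pCons)

lemma wmul_const_left [simp]: "wmul h [:p:] b = smult p b"
  by (simp add: wmul_pCons)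

lemma wmul_1_left [simp]: "wmul h 1 b = b"
  using wmul_const_left[of h 1 b] by (simp add: pCons_one del: wmul_const_left)

lemma genY_pCons: "genY = [:0, 1:]"
  by (simp add: genY_def monom_altdef)

lemma wmul_genY_left: "wmul h genY b = lmulY h b"
  by (simp add: genY_pCons wmul_pCons)

lemma wmul_add_left: "wmul h (a + a') b = wmul h a b + wmul h a' b"
  by (induction a a' arbitrary: b rule: poly_induct2)
    (simp_all add: wmul_pCons smult_add_left algebra_simps)

lemma wmul_add_right: "wmul h a (b + b') = wmul h a b + wmul h a b'"
  by (induction a arbitrary: b b')
    (simp_all add: wmul_pCons smult_add_right lmulY_add algebra_simps)

lemma wmul_smult_left: "wmul h (smult p a) b = smult p (wmul h a b)"
  by (induction a arbitrary: b) (simp_all add: wmul_pCons smult_add_right)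

text \<open>Associativity with \<open>y\<close> as left factor, which is what the recursive step of
  \<open>wmul_assoc\<close> needs.\<close>

lemma wmul_lmulY_left: "wmul h (lmulY h b) c = lmulY h (wmul h b c)"
  by (induction b arbitrary: c)
    (simp_all add: lmulY_pCons wmul_pCons wmul_add_left lmulY_add lmulY_smult algebra_simps)

lemma wmul_assoc: "wmul h (wmul h a b) c = wmul h a (wmul h b c)"
  by (induction a arbitrary: b)
    (simp_all add: wmul_pCons wmul_add_left wmul_smult_left wmul_lmulY_left)

lemma wmul_monom_right: "wmul h a (monom 1 n) = monom 1 n * a"
  by (induction a arbitrary: n)
    (simp_all add: wmul_pCons lmulY_monom, simp add: monom_Suc)

lemma wmul_genY_right: "wmul h a genY = pCons 0 a"
  by (simp add: genY_def wmul_monom_right, simp add: monom_altdef)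

lemma wmul_1_right [simp]: "wmul h a 1 = a"
  using wmul_monom_right[of h a 0] by simp

section \<open>Additivity of the \<open>y\<close>-degree, and commutativity modulo
  \<open>h\<close>\<close>

lemma degree_wmul_lead_coeff_wmul:
  assumes "a \<noteq> 0" "b \<noteq> 0"
  shows "degree (wmul h a b) = degree a + degree b \<and>
    lead_coeff (wmul h a b) = lead_coeff a * lead_coeff b"
  using assms
proof (induction a arbitrary: b)
  case 0
  then show ?case by simp
next
  case (pCons p a)
  show ?case
  proof (cases "a = 0")
    case True
    then show ?thesis using pCons by (auto simp: wmul_pCons lead_coeff_smult)
  next
    case False
    have nz: "lmulY h b \<noteq> 0" using degree_lmulY[OF pCons.prems(2), of h] by auto
    note IH = pCons.IH[OF False nz]
    \<comment> \<open>The summand \<open>p b\<close> has smaller \<open>y\<close>-degree than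
      \<open>a (y b)\<close>, so the top term comes from the latter.\<close>
    have "degree (smult p b) < degree (wmul h a (lmulY h b))"
      using IH degree_lmulY[OF pCons.prems(2), of h] degree_smult_le[of p b] by simp
    then show ?thesis
      using IH degree_lmulY[OF pCons.prems(2), of h] False
      by (auto simp: wmul_pCons degree_add_eq_right coeff_eq_0)
  qed
qed

lemma degree_wmul: "a \<noteq> 0 \<Longrightarrow> b \<noteq> 0 \<Longrightarrow> degree (wmul h a b) = degree a + degree b"
  using degree_wmul_lead_coeff_wmul by blast

lemma wmul_eq_mult_mod: "\<exists>c. wmul h a b = a * b + smult h c"
proof (induction a arbitrary: b)
  case 0
  show ?case by (auto intro: exI[of _ 0])
next
  case (pCons p a)
  obtain c where "wmul h a (lmulY h b) = a * lmulY h b + smult h c"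
    using pCons.IH by blast
  then have "wmul h (pCons p a) b = pCons p a * b + smult h (a * map_poly pderiv b + c)"
    by (simp add: wmul_pCons lmulY_eq_mult monom_altdef algebra_simps smult_add_right)
  then show ?case by blast
qed

section \<open>Homomorphisms and their values on the generators\<close>

definition weyl_hom ::
    "'a::field poly \<Rightarrow> 'a poly \<Rightarrow> ('a poly poly \<Rightarrow> 'a poly poly) \<Rightarrow> bool" where
  "weyl_hom h k \<theta> \<longleftrightarrow> (\<forall>a b. \<theta> (a + b) = \<theta> a + \<theta> b)
     \<and> (\<forall>c a. \<theta> (smult [:c:] a) = smult [:c:] (\<theta> a))
     \<and> (\<forall>a b. \<theta> (wmul h a b) = wmul k (\<theta> a) (\<theta> b))
     \<and> \<theta> 1 = 1"

text \<open>Bijectivity is split off so that the homomorphism lemmas also cover \<open>emb\<close>,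
  whose source and target are different algebras.\<close>

lemma is_aut_iff: "is_aut h \<phi> \<longleftrightarrow> bij \<phi> \<and> weyl_hom h h \<phi>"
  by (simp add: is_aut_def weyl_hom_def)

context
  fixes h k \<theta>
  assumes hom: "weyl_hom h k \<theta>"
begin

lemma weyl_hom_add: "\<theta> (a + b) = \<theta> a + \<theta> b"
  and weyl_hom_scale: "\<theta> (smult [:c:] a) = smult [:c:] (\<theta> a)"
  and weyl_hom_wmul: "\<theta> (wmul h a b) = wmul k (\<theta> a) (\<theta> b)"
  and weyl_hom_1: "\<theta> 1 = 1"
  using hom by (auto simp: weyl_hom_def)

lemma weyl_hom_0: "\<theta> 0 = 0"
  using weyl_hom_scale[of 0 0] by simp

lemma weyl_hom_scalar: "\<theta> [:[:c:]:] = [:[:c:]:]"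
  using weyl_hom_scale[of c 1] by (simp add: weyl_hom_1)

lemma weyl_hom_diff: "\<theta> (a - b) = \<theta> a - \<theta> b"
  using weyl_hom_add[of "a - b" b] by simp

text \<open>Horner's scheme in \<open>x\<close>; together with the one in \<open>y\<close> in
  \<open>weyl_hom_pCons\<close> it reduces \<theta> to its values at \<open>genX\<close> and
  \<open>genY\<close>.\<close>

lemma weyl_hom_const_pCons: "\<theta> [:pCons c p:] = [:[:c:]:] + wmul k (\<theta> genX) (\<theta> [:p:])"
proof -
  have "[:pCons c p:] = [:[:c:]:] + wmul h genX [:p:]"
    by (simp add: genX_def)
  then show ?thesis
    by (simp only: weyl_hom_add weyl_hom_wmul weyl_hom_scalar)
qed

lemma weyl_hom_pCons: "\<theta> (pCons p a) = \<theta> [:p:] + wmul k (\<theta> a) (\<theta> genY)"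
proof -
  have "pCons p a = [:p:] + wmul h a genY"
    by (simp add: wmul_genY_right)
  then show ?thesis
    by (simp only: weyl_hom_add weyl_hom_wmul)
qed

lemma weyl_hom_const:
  assumes "\<theta> genX = [:l:]"
  shows "\<theta> [:p:] = [:pcompose p l:]"
  by (induction p)
    (simp_all add: weyl_hom_0 weyl_hom_const_pCons assms pcompose_pCons)

lemma weyl_hom_smult:
  assumes "\<theta> genX = [:l:]"
  shows "\<theta> (smult p a) = smult (pcompose p l) (\<theta> a)"
  using weyl_hom_wmul[of "[:p:]" a] by (simp add: weyl_hom_const[OF assms])

end

lemma weyl_hom_eqI:
  assumes "weyl_hom h k \<theta>" "weyl_hom h k \<eta>" "\<theta> genX = \<eta> genX" "\<theta> genY = \<eta> genY"
  shows "\<theta> = \<eta>"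
proof
  fix a
  have const: "\<theta> [:p:] = \<eta> [:p:]" for p
    by (induction p)
      (simp_all add: weyl_hom_0[OF assms(1)] weyl_hom_0[OF assms(2)] assms(3)
        weyl_hom_const_pCons[OF assms(1)] weyl_hom_const_pCons[OF assms(2)])
  show "\<theta> a = \<eta> a"
  proof (induction a)
    case 0
    show ?case by (simp add: weyl_hom_0[OF assms(1)] weyl_hom_0[OF assms(2)])
  next
    case (pCons p a)
    then show ?case
      using weyl_hom_pCons[OF assms(1), of p a] weyl_hom_pCons[OF assms(2), of p a]
      by (simp only: const assms(4))
  qed
qed

lemma weyl_hom_compose:
  "weyl_hom h k \<theta> \<Longrightarrow> weyl_hom k m \<eta> \<Longrightarrow> weyl_hom h m (\<lambda>a. \<eta> (\<theta> a))"
  by (simp add: weyl_hom_def)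

lemma weyl_hom_id: "weyl_hom h h (\<lambda>a. a)"
  by (simp add: weyl_hom_def)

lemma is_aut_inv:
  assumes "is_aut h \<phi>"
  shows "is_aut h (inv \<phi>)"
proof -
  have b: "bij \<phi>" and hom: "weyl_hom h h \<phi>" using assms by (auto simp: is_aut_iff)
  have eq: "inv \<phi> a = b \<longleftrightarrow> a = \<phi> b" for a b
    using b by (metis bij_inv_eq_iff)
  have s: "\<phi> (inv \<phi> a) = a" for a using b by (simp add: bij_is_surj surj_f_inv_f)
  show ?thesis
    using b unfolding is_aut_iff weyl_hom_def
    by (simp add: bij_imp_bij_inv eq s weyl_hom_add[OF hom] weyl_hom_scale[OF hom]
        weyl_hom_wmul[OF hom] weyl_hom_1[OF hom])
qed

section \<open>Homomorphisms with prescribed values on F[x] and \<open>y\<close>\<close>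

definition weyl_ext ::
    "'a::field poly \<Rightarrow> ('a poly \<Rightarrow> 'a poly) \<Rightarrow> 'a poly poly \<Rightarrow> 'a poly poly \<Rightarrow> 'a poly poly" where
  "weyl_ext k \<sigma> v a = (\<Sum>i\<le>degree a. wmul k [:\<sigma> (coeff a i):] (wpow k v i))"

lemma wpow_Suc_right: "wpow k v (Suc n) = wmul k (wpow k v n) v"
proof (induction n)
  case (Suc n)
  have "wpow k v (Suc (Suc n)) = wmul k v (wmul k (wpow k v n) v)"
    using Suc by simp
  then show ?case by (simp add: wmul_assoc)
qed simp

lemma wmul_sum_left: "wmul k (\<Sum>i\<in>A. f i) b = (\<Sum>i\<in>A. wmul k (f i) b)"
  by (induction A rule: infinite_finite_induct) (simp_all add: wmul_add_left)

context
  fixes \<sigma> :: "'a::field poly \<Rightarrow> 'a poly" and h k v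
  assumes \<sigma>_add: "\<And>p q. \<sigma> (p + q) = \<sigma> p + \<sigma> q"
    and \<sigma>_times: "\<And>p q. \<sigma> (p * q) = \<sigma> p * \<sigma> q"
    and \<sigma>_scalar: "\<And>c. \<sigma> [:c:] = [:c:]"
    and rel: "\<And>p. wmul k v [:\<sigma> p:] = smult (\<sigma> p) v + [:\<sigma> (wdelta h p):]"
begin

lemma weyl_ext_0: "weyl_ext k \<sigma> v 0 = 0"
  using \<sigma>_scalar[of 0] by (simp add: weyl_ext_def)

lemma weyl_ext_pCons: "weyl_ext k \<sigma> v (pCons p a) = [:\<sigma> p:] + wmul k (weyl_ext k \<sigma> v a) v"
proof (cases "a = 0")
  case True
  then show ?thesis by (simp add: weyl_ext_0) (simp add: weyl_ext_def)
next
  case False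
  then show ?thesis
    by (simp add: weyl_ext_def sum.atMost_Suc_shift wpow_Suc_right wmul_sum_left wmul_smult_left
        del: sum.atMost_Suc wpow.simps(2))
qed

lemma weyl_ext_add: "weyl_ext k \<sigma> v (a + b) = weyl_ext k \<sigma> v a + weyl_ext k \<sigma> v b"
  by (induction a b rule: poly_induct2)
    (simp_all add: weyl_ext_0 weyl_ext_pCons wmul_add_left \<sigma>_add)

lemma weyl_ext_smult: "weyl_ext k \<sigma> v (smult p a) = smult (\<sigma> p) (weyl_ext k \<sigma> v a)"
  by (induction a)
    (simp_all add: weyl_ext_0 weyl_ext_pCons wmul_smult_left smult_add_right \<sigma>_times)

text \<open>The assumption \<open>rel\<close> is the image of the relation
  \<open>y p = p y + \<delta>(p)\<close>. It makes \<open>weyl_ext\<close> respect left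
  multiplication by \<open>y\<close> and hence, by recursion on the left factor, all
  products.\<close>

lemma weyl_ext_lmulY: "weyl_ext k \<sigma> v (lmulY h b) = wmul k v (weyl_ext k \<sigma> v b)"
proof (induction b)
  case (pCons p b)
  then show ?case
    by (simp add: lmulY_pCons weyl_ext_pCons weyl_ext_add weyl_ext_0 wmul_add_left
        wmul_add_right rel wmul_assoc)
qed (simp add: weyl_ext_0)

lemma weyl_ext_wmul:
  "weyl_ext k \<sigma> v (wmul h a b) = wmul k (weyl_ext k \<sigma> v a) (weyl_ext k \<sigma> v b)"
  by (induction a arbitrary: b)
    (simp_all add: weyl_ext_0 wmul_pCons weyl_ext_pCons weyl_ext_add weyl_ext_smult
      weyl_ext_lmulY wmul_add_left wmul_assoc)

lemma weyl_ext_const: "weyl_ext k \<sigma> v [:p:] = [:\<sigma> p:]"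
  by (simp add: weyl_ext_pCons weyl_ext_0)

lemma weyl_ext_genX: "weyl_ext k \<sigma> v genX = [:\<sigma> [:0, 1:]:]"
  by (simp add: genX_def weyl_ext_const)

lemma weyl_ext_genY: "weyl_ext k \<sigma> v genY = v"
  using \<sigma>_scalar[of 0] \<sigma>_scalar[of 1]
  by (simp add: genY_pCons weyl_ext_pCons weyl_ext_0, simp add: pCons_one)

lemma weyl_hom_weyl_ext: "weyl_hom h k (weyl_ext k \<sigma> v)"
  using weyl_ext_const[of 1] \<sigma>_scalar[of 1]
  by (simp add: weyl_hom_def weyl_ext_add weyl_ext_smult weyl_ext_wmul \<sigma>_scalar pCons_one)

end

section \<open>The embedding of \<open>A_g\<close> as a homomorphism\<close>

lemma wmul_genY_const: "wmul f genY [:r:] = [:f * pderiv r, r:]"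
  by (simp add: wmul_genY_left lmulY_pCons wdelta_def)

lemma wmul_linear_const: "wmul f [:b, a:] [:s:] = [:b * s + a * (f * pderiv s), a * s:]"
  by (simp add: wmul_pCons lmulY_pCons wdelta_def)

lemma emb_eq_weyl_ext: "emb f r = weyl_ext f (\<lambda>p. p) (wmul f genY [:r:])"
  by (rule ext) (simp add: emb_def weyl_ext_def)

text \<open>The commutator of \<open>y r\<close> with \<open>p\<close> is \<open>r f p'\<close>, so
  \<open>y r\<close> satisfies the relation required of the second generator of
  \<open>A_g\<close>.\<close>

lemma emb_relation:
  "wmul f (wmul f genY [:r:]) [:p:] = smult p (wmul f genY [:r:]) + [:wdelta (r * f) p:]"
  by (simp add: wmul_genY_const wmul_linear_const wdelta_def algebra_simps)

lemma weyl_hom_emb: "weyl_hom (r * f) f (emb f r)"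
  unfolding emb_eq_weyl_ext by (rule weyl_hom_weyl_ext) (simp_all add: emb_relation)

lemma emb_genY: "emb f r genY = [:f * pderiv r, r:]"
  unfolding emb_eq_weyl_ext
  by (subst weyl_ext_genY[where h = "r * f"]) (simp_all add: emb_relation, simp add: wmul_genY_const)

lemma emb_const: "emb f r [:p:] = [:p:]"
  unfolding emb_eq_weyl_ext
  by (subst weyl_ext_const[where h = "r * f"]) (simp_all add: emb_relation)

lemma emb_linear: "emb f r [:b, a:] = [:b + a * (f * pderiv r), a * r:]"
  using weyl_hom_pCons[OF weyl_hom_emb, of f r b "[:a:]"]
  by (simp add: emb_const emb_genY)

lemma range_emb_add:
  assumes "u \<in> range (emb f r)" "v \<in> range (emb f r)"
  shows "u + v \<in> range (emb f r)"
  using assms by (auto simp flip: weyl_hom_add[OF weyl_hom_emb])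

lemma range_emb_wmul:
  assumes "u \<in> range (emb f r)" "v \<in> range (emb f r)"
  shows "wmul f u v \<in> range (emb f r)"
  using assms by (auto simp flip: weyl_hom_wmul[OF weyl_hom_emb])


section \<open>Affine automorphisms of \<open>A_f\<close>\<close>

lemma pcompose_affine_inverse:
  fixes \<alpha> \<beta> :: "'a::field"
  assumes "\<alpha> \<noteq> 0"
  shows "pcompose (pcompose p [:\<beta>, \<alpha>:]) [:- \<beta> / \<alpha>, 1 / \<alpha>:] = p"
    "pcompose (pcompose p [:- \<beta> / \<alpha>, 1 / \<alpha>:]) [:\<beta>, \<alpha>:] = p"
  using assms by (simp_all add: pcompose_assoc[symmetric] pcompose_pCons)

text \<open>Dividing by \<alpha>, rather than using the truncated exponent
  \<open>degree f - 1\<close>, gives the right factor also for constant \<open>f\<close>.\<close>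

lemma affine_weyl_hom_exists:
  fixes \<alpha> \<beta> :: "'a::field"
  assumes \<alpha>: "\<alpha> \<noteq> 0" and f: "pcompose f [:\<beta>, \<alpha>:] = smult (\<alpha> ^ degree f) f"
  obtains \<theta> where "weyl_hom f f \<theta>" "\<theta> genX = [:[:\<beta>, \<alpha>:]:]"
    "\<theta> genY = smult [:\<alpha> ^ degree f / \<alpha>:] (genY + [:t:])"
proof -
  define \<sigma> where "\<sigma> = (\<lambda>p. pcompose p [:\<beta>, \<alpha>:])"
  define v where "v = smult [:\<alpha> ^ degree f / \<alpha>:] (genY + [:t:])"
  have v: "v = [:smult (\<alpha> ^ degree f / \<alpha>) t, [:\<alpha> ^ degree f / \<alpha>:]:]"
    by (simp add: v_def genY_pCons)
  \<comment> \<open>The chain rule contributes a factor \<alpha> that cancels the division by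
    \<alpha>; the remaining \<open>\<alpha> ^ degree f\<close> turns \<open>f\<close> into
    f(\<alpha>x+\<beta>).\<close>
  have rel: "wmul f v [:\<sigma> p:] = smult (\<sigma> p) v + [:\<sigma> (wdelta f p):]" for p
    using \<alpha> f
    by (simp add: v wmul_linear_const \<sigma>_def wdelta_def pderiv_pcompose pderiv_pCons
        pcompose_mult algebra_simps)
  have \<sigma>: "\<And>p q. \<sigma> (p + q) = \<sigma> p + \<sigma> q" "\<And>p q. \<sigma> (p * q) = \<sigma> p * \<sigma> q"
    "\<And>c. \<sigma> [:c:] = [:c:]"
    by (simp_all add: \<sigma>_def pcompose_add pcompose_mult)
  show thesis
  proof
    show "weyl_hom f f (weyl_ext f \<sigma> v)"
      by (rule weyl_hom_weyl_ext[OF \<sigma> rel])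
    show "weyl_ext f \<sigma> v genX = [:[:\<beta>, \<alpha>:]:]"
      by (simp add: weyl_ext_genX[OF \<sigma> rel]) (simp add: \<sigma>_def pcompose_pCons)
    show "weyl_ext f \<sigma> v genY = smult [:\<alpha> ^ degree f / \<alpha>:] (genY + [:t:])"
      by (simp add: weyl_ext_genY[OF \<sigma> rel]) (simp add: v_def)
  qed
qed

text \<open>The inverse has the same shape for the inverse substitution \<open>l'\<close>, so the
  previous lemma supplies both maps; that they are mutually inverse is checked on the
  generators.\<close>

lemma affine_aut_exists:
  fixes \<alpha> \<beta> :: "'a::field"
  assumes \<alpha>: "\<alpha> \<noteq> 0" and f: "pcompose f [:\<beta>, \<alpha>:] = smult (\<alpha> ^ degree f) f"
  obtains \<phi> where "is_aut f \<phi>" "\<phi> genX = [:[:\<beta>, \<alpha>:]:]"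
    "\<phi> genY = smult [:\<alpha> ^ degree f / \<alpha>:] (genY + [:t:])"
proof -
  define c where "c = \<alpha> ^ degree f / \<alpha>"
  define l where "l = [:\<beta>, \<alpha>:]"
  define l' where "l' = [:- \<beta> / \<alpha>, 1 / \<alpha>:]"
  have c0: "c \<noteq> 0" using \<alpha> by (simp add: c_def)
  have c': "(1 / \<alpha>) ^ degree f / (1 / \<alpha>) = 1 / c"
    by (simp add: c_def power_divide)
  have ll': "pcompose (pcompose p l) l' = p" "pcompose (pcompose p l') l = p" for p
    unfolding l_def l'_def by (rule pcompose_affine_inverse[OF \<alpha>])+
  have "f = smult (\<alpha> ^ degree f) (pcompose f l')"
    using ll'(1)[of f] f by (simp add: l_def pcompose_smult)
  then have "smult ((1 / \<alpha>) ^ degree f) f =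
      smult ((1 / \<alpha>) ^ degree f) (smult (\<alpha> ^ degree f) (pcompose f l'))"
    by simp
  then have f': "pcompose f l' = smult ((1 / \<alpha>) ^ degree f) f"
    using \<alpha> by (simp add: power_mult_distrib[symmetric])
  obtain \<phi> where \<phi>: "weyl_hom f f \<phi>" "\<phi> genX = [:l:]" "\<phi> genY = smult [:c:] (genY + [:t:])"
    using affine_weyl_hom_exists[OF \<alpha> f, of t] by (auto simp: c_def l_def)
  \<comment> \<open>If \<open>s\<close> denotes the shift of \<eta>, then \<eta>(\<phi>(y)) = y + s
    + c t(l'), which forces s = -c t(l').\<close>
  obtain \<eta> where \<eta>: "weyl_hom f f \<eta>" "\<eta> genX = [:l':]"
      "\<eta> genY = smult [:1 / c:] (genY + [:- smult c (pcompose t l'):])"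
    using affine_weyl_hom_exists[of "1 / \<alpha>" f "- \<beta> / \<alpha>" "- smult c (pcompose t l')"] \<alpha> f' c'
    by (auto simp: l'_def)
  have l: "pcompose l l' = [:0, 1:]" "pcompose l' l = [:0, 1:]"
    using ll'[of "[:0, 1:]"] by (simp_all add: pcompose_pCons)
  have "(\<lambda>a. \<eta> (\<phi> a)) = (\<lambda>a. a)"
  proof (rule weyl_hom_eqI[OF weyl_hom_compose[OF \<phi>(1) \<eta>(1)] weyl_hom_id])
    show "\<eta> (\<phi> genX) = genX"
      by (simp add: \<phi>(2) weyl_hom_const[OF \<eta>(1,2)] l, simp add: genX_def)
    show "\<eta> (\<phi> genY) = genY"
      using c0 by (simp add: \<phi> \<eta> weyl_hom_scale[OF \<eta>(1)] weyl_hom_add[OF \<eta>(1)]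
          weyl_hom_const[OF \<eta>(1,2)] smult_add_right pcompose_smult pCons_one)
  qed
  moreover have "(\<lambda>a. \<phi> (\<eta> a)) = (\<lambda>a. a)"
  proof (rule weyl_hom_eqI[OF weyl_hom_compose[OF \<eta>(1) \<phi>(1)] weyl_hom_id])
    show "\<phi> (\<eta> genX) = genX"
      by (simp add: \<eta>(2) weyl_hom_const[OF \<phi>(1,2)] l, simp add: genX_def)
    show "\<phi> (\<eta> genY) = genY"
      using c0 by (simp add: \<phi> \<eta> weyl_hom_scale[OF \<phi>(1)] weyl_hom_add[OF \<phi>(1)]
          weyl_hom_const[OF \<phi>(1,2)] smult_add_right pcompose_smult pcompose_uminus ll'
          pCons_one)
  qed
  ultimately have "bij \<phi>"
    by (intro o_bij[of \<eta>]) (auto simp: fun_eq_iff)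
  then show thesis
    using that \<phi> by (simp add: is_aut_iff c_def l_def)
qed

section \<open>Semi-invariant polynomials and necessary conditions for an extension\<close>

lemma pcompose_affine_eq_smult:
  fixes \<alpha> \<beta> :: "'a::field"
  assumes "\<alpha> \<noteq> 0" "pcompose p [:\<beta>, \<alpha>:] = smult k p" "p \<noteq> 0"
  shows "k = \<alpha> ^ degree p"
proof -
  have "lead_coeff (pcompose p [:\<beta>, \<alpha>:]) = lead_coeff p * \<alpha> ^ degree p"
    using assms(1) by (subst lead_coeff_comp) auto
  moreover have "lead_coeff (smult k p) = k * lead_coeff p"
    by (simp add: lead_coeff_smult)
  ultimately show ?thesis using assms(2,3) by simp
qed

text \<open>Composition is multiplicative and \<open>\<alpha> ^ degree (p * q)\<close> splits along
  the factors, so the contribution of \<open>p\<close> cancels.\<close>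

lemma pcompose_affine_cofactor:
  fixes \<alpha> \<beta> :: "'a::field"
  assumes "\<alpha> \<noteq> 0" "p \<noteq> 0" "q \<noteq> 0"
    and p: "pcompose p [:\<beta>, \<alpha>:] = smult (\<alpha> ^ degree p) p"
    and pq: "pcompose (p * q) [:\<beta>, \<alpha>:] = smult (\<alpha> ^ degree (p * q)) (p * q)"
  shows "pcompose q [:\<beta>, \<alpha>:] = smult (\<alpha> ^ degree q) q"
proof -
  have "smult (\<alpha> ^ degree p) p * pcompose q [:\<beta>, \<alpha>:] =
      smult (\<alpha> ^ degree p) p * smult (\<alpha> ^ degree q) q"
    using pq assms(2,3) p by (simp add: pcompose_mult degree_mult_eq power_add mult.commute)
  then show ?thesis using assms(1,2)
    by (metis mult_left_cancel power_not_zero smult_eq_0_iff)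
qed

lemma degree_eq_1E:
  assumes "degree p = 1"
  obtains a b where "p = [:a, b:]" "b \<noteq> 0"
proof -
  obtain a p' where p: "p = pCons a p'" by (cases p)
  then have "degree p' = 0" "p' \<noteq> 0"
    using assms by (auto simp: degree_pCons_eq_if split: if_splits)
  then show thesis using that p by (metis degree_eq_zeroE pCons_0_0)
qed

lemma extension_conditions:
  fixes \<alpha> \<beta> :: "'a::field"
  assumes \<alpha>: "\<alpha> \<noteq> 0" and rf: "r * f \<noteq> 0" and c: "c \<noteq> 0"
    and g: "pcompose (r * f) [:\<beta>, \<alpha>:] = smult (\<alpha> ^ degree (r * f)) (r * f)"
    and \<phi>: "weyl_hom f f \<phi>" "\<phi> genX = [:[:\<beta>, \<alpha>:]:]"
    and \<phi>Y: "\<phi> (wmul f genY [:r:]) = smult [:c:] (wmul f genY [:r:] + [:q:])"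
  shows "pcompose f [:\<beta>, \<alpha>:] = smult (\<alpha> ^ degree f) f" "r dvd q"
proof -
  define s where "s = pcompose r [:\<beta>, \<alpha>:]"
  have r0: "r \<noteq> 0" and f0: "f \<noteq> 0" using rf by auto
  have deg_s: "degree s = degree r" using \<alpha> by (simp add: s_def degree_pcompose)
  have s0: "s \<noteq> 0"
    using r0 \<alpha> unfolding s_def by (simp add: pcompose_eq_0_iff)
  have eq: "wmul f (\<phi> genY) [:s:] = [:smult c (f * pderiv r + q), smult c r:]"
    using \<phi>Y unfolding weyl_hom_wmul[OF \<phi>(1)] weyl_hom_const[OF \<phi>]
    by (simp add: s_def wmul_genY_const)
  \<comment> \<open>The product with \<open>s\<close> has \<open>y\<close>-degree 1 and
    \<open>s\<close> has \<open>y\<close>-degree 0, so \<phi>(y) must have \<open>y\<close>-degree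
    1.\<close>
  have "\<phi> genY \<noteq> 0" using eq c r0 by auto
  then have "degree (\<phi> genY) = 1"
    using degree_wmul[of "\<phi> genY" "[:s:]" f] eq s0 c r0 by simp
  then obtain b a where ba: "\<phi> genY = [:b, a:]"
    by (rule degree_eq_1E)
  have as: "a * s = smult c r" and bs: "b * s + a * (f * pderiv s) = smult c (f * pderiv r + q)"
    using eq by (simp_all add: ba wmul_linear_const)
  have a0: "a \<noteq> 0" using as c r0 by auto
  \<comment> \<open>The affine substitution preserves the degree of \<open>r\<close>, so
    \<open>a s = c r\<close> forces \<open>a\<close> to be constant.\<close>
  have "degree a + degree s = degree r"
    using arg_cong[OF as, of degree] c a0 s0 by (simp add: degree_mult_eq)
  then obtain e where e: "a = [:e:]"
    using deg_s by (metis add_eq_self_zero add.commute degree_eq_zeroE)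
  have e0: "e \<noteq> 0" using e a0 by simp
  have "smult (1 / e) (smult e s) = smult (1 / e) (smult c r)" using as e by simp
  then have s: "s = smult (c / e) r" using e0 by simp
  \<comment> \<open>With s = (c/e) r the two terms containing derivatives agree and cancel.\<close>
  have bq: "b * s = smult c q"
    using bs e0 by (simp add: e s pderiv_smult smult_add_right)
  have "smult (1 / e) (b * r) = q"
    using arg_cong[OF bq, of "smult (1 / c)"] c by (simp add: s)
  then have "q = r * smult (1 / e) b" by (simp add: mult.commute)
  then show "r dvd q" by (rule dvdI)
  \<comment> \<open>Leading coefficients identify \<open>c / e\<close> with
    \<open>\<alpha> ^ degree r\<close>.\<close>
  have "pcompose r [:\<beta>, \<alpha>:] = smult (\<alpha> ^ degree r) r"
    using pcompose_affine_eq_smult[OF \<alpha>, of r \<beta> "c / e"] s r0 by (simp add: s_def)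
  from pcompose_affine_cofactor[OF \<alpha> r0 f0 this g]
  show "pcompose f [:\<beta>, \<alpha>:] = smult (\<alpha> ^ degree f) f" .
qed

section \<open>Automorphisms of \<open>A_f\<close> that preserve the image of
  \<open>A_g\<close>\<close>

lemma degree_inj_weyl_hom_const:
  assumes \<psi>: "weyl_hom h k \<psi>" and inj: "inj \<psi>" and "p \<noteq> 0"
  shows "degree (\<psi> [:p:]) = degree p * degree (\<psi> genX)"
  using \<open>p \<noteq> 0\<close>
proof (induction p)
  case (pCons c p)
  \<comment> \<open>Injectivity keeps images of nonzero elements nonzero, so degrees add in each
    Horner step; the added scalar cannot change the \<open>y\<close>-degree.\<close>
  note nz = inj_eq[OF inj, of _ 0, unfolded weyl_hom_0[OF \<psi>]]
  show ?case
  proof (cases "p = 0")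
    case True
    then show ?thesis by (simp add: weyl_hom_scalar[OF \<psi>])
  next
    case False
    have "degree (wmul k (\<psi> genX) (\<psi> [:p:])) = degree (pCons c p) * degree (\<psi> genX)"
      using False pCons.IH by (simp add: degree_wmul nz genX_def)
    moreover have "degree ([:[:c:]:] + u) = degree u" for u :: "'a poly poly"
      by (cases "degree u = 0") (auto simp: degree_add_eq_right elim: degree_eq_zeroE)
    ultimately show ?thesis by (simp add: weyl_hom_const_pCons[OF \<psi>])
  qed
qed simp

text \<open>Once \<psi>(x) lies in F[x], images of coefficients have \<open>y\<close>-degree 0, and
  each Horner step in \<open>y\<close> adds the degree of \<psi>(y).\<close>

lemma degree_inj_weyl_hom:
  assumes \<psi>: "weyl_hom h k \<psi>" and inj: "inj \<psi>" and X: "\<psi> genX = [:l:]" and "a \<noteq> 0"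
  shows "degree (\<psi> a) = degree a * degree (\<psi> genY)"
  using \<open>a \<noteq> 0\<close>
proof (induction a)
  case (pCons p a)
  note nz = inj_eq[OF inj, of _ 0, unfolded weyl_hom_0[OF \<psi>]]
  show ?case
  proof (cases "a = 0")
    case True
    then show ?thesis by (simp add: weyl_hom_const[OF \<psi> X])
  next
    case False
    have "degree (wmul k (\<psi> a) (\<psi> genY)) = degree (pCons p a) * degree (\<psi> genY)"
      using False pCons.IH by (simp add: degree_wmul nz genY_pCons)
    moreover have "degree ([:q:] + u) = degree u" for q :: "'a poly" and u
      by (cases "degree u = 0") (auto simp: degree_add_eq_right elim: degree_eq_zeroE)
    ultimately show ?thesis by (simp add: weyl_hom_pCons[OF \<psi>, of p a] weyl_hom_const[OF \<psi> X])
  qed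
qed simp

text \<open>One inclusion suffices: the inverse automorphism satisfies the same hypotheses with
  \<open>1 / c\<close> and provides the other.\<close>

lemma aut_image_emb_subset:
  assumes aut: "is_aut f \<psi>" and deg: "degree (r * f) \<ge> 1"
    and c: "c \<noteq> 0" "\<psi> [:r * f:] = smult [:c:] [:r * f:]"
  shows "\<psi> ` range (emb f r) \<subseteq> range (emb f r)"
proof -
  have \<psi>: "weyl_hom f f \<psi>" and inj: "inj \<psi>" and surj: "surj \<psi>"
    using aut by (auto simp: is_aut_iff bij_def)
  have rf: "r * f \<noteq> 0" using deg by auto
  then have r0: "r \<noteq> 0" and f0: "f \<noteq> 0" by auto
  \<comment> \<open>The image of \<open>g = r f\<close> has \<open>y\<close>-degree 0 while
    \<open>g\<close> is nonconstant in \<open>x\<close>, so \<psi>(x) has \<open>y\<close>-degree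
    0.\<close>
  have "degree (r * f) * degree (\<psi> genX) = 0"
    using degree_inj_weyl_hom_const[OF \<psi> inj rf] c by simp
  then obtain l where l: "\<psi> genX = [:l:]"
    using deg by (metis degree_eq_zeroE mult_is_0 not_one_le_zero)
  have g: "pcompose (r * f) l = smult c (r * f)"
    using weyl_hom_const[OF \<psi> l, of "r * f"] c by simp
  have "degree (r * f) * degree l = degree (r * f)"
    using arg_cong[OF g, of degree] c(1) by (simp add: degree_pcompose)
  then have "degree l = 1" using deg by simp
  then obtain \<beta> \<alpha> where l_eq: "l = [:\<beta>, \<alpha>:]" and \<alpha>: "\<alpha> \<noteq> 0"
    by (rule degree_eq_1E)
  \<comment> \<open>Surjectivity enters through a preimage of \<open>y\<close>: its
    \<open>y\<close>-degree times that of \<psi>(y) is 1.\<close>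
  define a where "a = inv \<psi> genY"
  have a: "\<psi> a = genY" by (simp add: a_def surj_f_inv_f[OF surj])
  have "a \<noteq> 0" using a weyl_hom_0[OF \<psi>] by (auto simp: genY_pCons)
  then have "degree a * degree (\<psi> genY) = 1"
    using degree_inj_weyl_hom[OF \<psi> inj l, of a] by (simp add: a) (simp add: genY_pCons)
  then have "degree a = 1" "degree (\<psi> genY) = 1" by auto
  then obtain a0 a1 b e' where ae: "a = [:a0, a1:]" "\<psi> genY = [:b, e':]"
    by (elim degree_eq_1E)
  have "\<psi> a = [:pcompose a0 l:] + smult (pcompose a1 l) [:b, e':]"
    using weyl_hom_pCons[OF \<psi>, of a0 "[:a1:]"] by (simp add: ae weyl_hom_const[OF \<psi> l])
  \<comment> \<open>Comparing coefficients of \<open>y\<close> makes \<open>e'\<close> a unit of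
    F[x], hence a nonzero scalar.\<close>
  then have "pcompose a1 l * e' = 1" using a by (simp add: genY_pCons)
  then have "e' dvd 1" by (metis dvd_triv_right)
  then obtain e where e: "e' = [:e:]" "e \<noteq> 0"
    by (auto simp: is_unit_poly_iff dvd_field_iff)
  \<comment> \<open>Applying \<psi> to the defining relation of \<open>A_f\<close> yields the
    scaling factor of \<open>f\<close> under \<open>l\<close>.\<close>
  have "wmul f genY genX = smult [:0, 1:] genY + [:f:]"
    by (simp add: genX_def genY_pCons wmul_linear_const pderiv_pCons)
  from arg_cong[OF this, of \<psi>]
  have "wmul f [:b, [:e:]:] [:l:] = smult l [:b, [:e:]:] + [:pcompose f l:]"
    by (simp add: weyl_hom_wmul[OF \<psi>] weyl_hom_add[OF \<psi>] weyl_hom_smult[OF \<psi> l]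
        weyl_hom_const[OF \<psi> l] ae e l pcompose_pCons)
  then have f: "pcompose f l = smult (e * \<alpha>) f"
    by (simp add: wmul_linear_const l_eq pderiv_pCons algebra_simps)
  \<comment> \<open>The quotient of the scaling factors of \<open>r f\<close> and \<open>f\<close>
    is the one of \<open>r\<close>.\<close>
  define k where "k = c / (e * \<alpha>)"
  have "smult (e * \<alpha>) (pcompose r l) * f = smult c r * f"
    using g f by (simp add: pcompose_mult)
  then have "smult (e * \<alpha>) (pcompose r l) = smult c r"
    using f0 mult_right_cancel by blast
  from arg_cong[OF this, of "smult (1 / (e * \<alpha>))"]
  have r: "pcompose r l = smult k r"
    using e \<alpha> by (simp add: k_def)
  have "\<psi> (emb f r genY) = wmul f [:b, [:e:]:] [:smult k r:]"
    using weyl_hom_wmul[OF \<psi>, of genY "[:r:]"]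
    by (simp add: emb_genY wmul_genY_const weyl_hom_const[OF \<psi> l] ae e r)
  \<comment> \<open>The preimage is read off from \<open>emb_linear\<close>: matching the
    coefficient of \<open>y\<close> gives \<open>e * k\<close>, and this already accounts for the
    term with \<open>pderiv r\<close>.\<close>
  also have "\<dots> = emb f r [:smult k (b * r), [:e * k:]:]"
    by (simp add: wmul_linear_const emb_linear pderiv_smult algebra_simps)
  finally have Y: "\<psi> (emb f r genY) \<in> range (emb f r)" by simp
  \<comment> \<open>The image of \<open>A_g\<close> is generated by F[x] and \<open>y r\<close>, and
    both are now known to be mapped into it.\<close>
  have "\<psi> (emb f r a) \<in> range (emb f r)" for a
  proof (induction a)
    case 0
    show ?case
      using rangeI[of "emb f r" 0]
      by (simp add: weyl_hom_0[OF \<psi>] weyl_hom_0[OF weyl_hom_emb])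
  next
    case (pCons p a)
    have "\<psi> [:p:] \<in> range (emb f r)"
      using rangeI[of "emb f r" "[:pcompose p l:]"]
      by (simp add: weyl_hom_const[OF \<psi> l] emb_const)
    then show ?case
      using pCons.IH Y
      by (simp only: weyl_hom_pCons[OF weyl_hom_emb, of f r p a] emb_const
          weyl_hom_add[OF \<psi>] weyl_hom_wmul[OF \<psi>] range_emb_add range_emb_wmul)
  qed
  then show ?thesis by auto
qed

text \<open>\<open>g = [y r, x]\<close> is a commutator in \<open>A\<^sub>g\<close>, and \<open>A\<^sub>g\<close> is commutative modulo \<open>g\<close>.\<close>

lemma aut_image_emb_g:
  assumes \<psi>: "weyl_hom f f \<psi>" and sub: "\<psi> ` range (emb f r) \<subseteq> range (emb f r)"
  obtains z where "\<psi> [:r * f:] = smult (r * f) z"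
proof -
  have comm: "[:r * f:] = wmul f (emb f r genY) (emb f r genX) - wmul f (emb f r genX) (emb f r genY)"
    by (simp add: emb_genY genX_def emb_const wmul_linear_const pderiv_pCons)
  have "\<psi> (emb f r u) \<in> range (emb f r)" for u
    by (rule subsetD[OF sub]) (intro imageI rangeI)
  then obtain a b where a: "\<psi> (emb f r genY) = emb f r a" and b: "\<psi> (emb f r genX) = emb f r b"
    unfolding image_iff by meson
  obtain c where c: "wmul (r * f) a b = a * b + smult (r * f) c"
    using wmul_eq_mult_mod[of "r * f" a b] by blast
  obtain d where d: "wmul (r * f) b a = b * a + smult (r * f) d"
    using wmul_eq_mult_mod[of "r * f" b a] by blast
  have "\<psi> [:r * f:] = emb f r (wmul (r * f) a b - wmul (r * f) b a)"
    unfolding weyl_hom_diff[OF weyl_hom_emb] weyl_hom_wmul[OF weyl_hom_emb] a[symmetric] b[symmetric]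
    by (subst comm) (simp only: weyl_hom_diff[OF \<psi>] weyl_hom_wmul[OF \<psi>])
  also have "wmul (r * f) a b - wmul (r * f) b a = wmul (r * f) [:r * f:] (c - d)"
    unfolding c d by (simp add: smult_diff_right mult.commute[of a b])
  also have "emb f r \<dots> = smult (r * f) (emb f r (c - d))"
    unfolding weyl_hom_wmul[OF weyl_hom_emb] by (simp add: emb_const)
  finally show thesis by (rule that)
qed

lemma aut_preserves_emb_iff:
  assumes aut: "is_aut f \<psi>" and deg: "degree (r * f) \<ge> 1"
  shows "\<psi> ` range (emb f r) = range (emb f r)
    \<longleftrightarrow> (\<exists>c. c \<noteq> 0 \<and> \<psi> [:r * f:] = smult [:c:] [:r * f:])"
proof
  have \<psi>: "weyl_hom f f \<psi>" and bij: "bij \<psi>"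
    using aut by (auto simp: is_aut_iff)
  have aut': "is_aut f (inv \<psi>)" by (rule is_aut_inv[OF aut])
  then have \<psi>': "weyl_hom f f (inv \<psi>)" by (simp add: is_aut_iff)
  have inv: "inv \<psi> (\<psi> a) = a" "\<psi> (inv \<psi> a) = a" for a
    using bij by (simp_all add: bij_is_inj bij_is_surj surj_f_inv_f)
  have rf: "r * f \<noteq> 0" using deg by auto
  {
    assume im: "\<psi> ` range (emb f r) = range (emb f r)"
    then have im': "inv \<psi> ` range (emb f r) = range (emb f r)"
      by (metis bij bij_is_inj image_inv_f_f)
    obtain z where z: "\<psi> [:r * f:] = smult (r * f) z"
      using aut_image_emb_g[OF \<psi>] im by blast
    obtain z' where z': "inv \<psi> [:r * f:] = smult (r * f) z'"
      using aut_image_emb_g[OF \<psi>'] im' by blast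
    \<comment> \<open>Inserting both factorizations into \<psi>(inv \<psi> g) = g and cancelling
      \<open>g\<close> makes \<open>z\<close> invertible; additivity of degrees then puts it in
      F[x], where units are scalars.\<close>
    have "[:r * f:] = \<psi> (wmul f [:r * f:] z')"
      using inv(2)[of "[:r * f:]"] z' by simp
    also have "\<dots> = smult (r * f) (wmul f z (\<psi> z'))"
      by (simp only: weyl_hom_wmul[OF \<psi>] z wmul_smult_left)
    finally have "smult (r * f) (wmul f z (\<psi> z')) = smult (r * f) 1"
      by (simp add: one_pCons)
    then have one: "wmul f z (\<psi> z') = 1"
      using rf by (metis smult_diff_right smult_eq_0_iff right_minus_eq)
    then have "z \<noteq> 0" "\<psi> z' \<noteq> 0" by auto
    then have "degree z = 0" "degree (\<psi> z') = 0"
      using degree_wmul[of z "\<psi> z'" f] one by simp_all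
    then obtain u w where uw: "z = [:u:]" "\<psi> z' = [:w:]"
      by (metis degree_eq_zeroE)
    then have "u * w = 1" using one by (simp add: one_pCons)
    then have "u dvd 1" by (metis dvd_triv_left)
    then obtain c where "u = [:c:]" "c \<noteq> 0"
      by (auto simp: is_unit_poly_iff dvd_field_iff)
    then show "\<exists>c. c \<noteq> 0 \<and> \<psi> [:r * f:] = smult [:c:] [:r * f:]"
      using z uw by (auto simp: mult.commute)
  }
  {
    assume "\<exists>c. c \<noteq> 0 \<and> \<psi> [:r * f:] = smult [:c:] [:r * f:]"
    then obtain c where c: "c \<noteq> 0" "\<psi> [:r * f:] = smult [:c:] [:r * f:]" by blast
    have "[:r * f:] = smult [:c:] (inv \<psi> [:r * f:])"
      using arg_cong[OF c(2), of "inv \<psi>"] unfolding inv weyl_hom_scale[OF \<psi>'] .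
    from arg_cong[OF this, of "smult [:1 / c:]"]
    have c': "inv \<psi> [:r * f:] = smult [:1 / c:] [:r * f:]"
      using c(1) by (simp add: pCons_one)
    have "\<psi> ` range (emb f r) \<subseteq> range (emb f r)"
      by (rule aut_image_emb_subset[OF aut deg c])
    moreover have "inv \<psi> ` range (emb f r) \<subseteq> range (emb f r)"
      by (rule aut_image_emb_subset[OF aut' deg _ c']) (use c in simp)
    then have "\<psi> ` inv \<psi> ` range (emb f r) \<subseteq> \<psi> ` range (emb f r)"
      by (rule image_mono)
    then have "range (emb f r) \<subseteq> \<psi> ` range (emb f r)"
      by (simp add: image_image inv)
    ultimately show "\<psi> ` range (emb f r) = range (emb f r)"
      by (rule subset_antisym)
  }
qed

section \<open>The extension criterion\<close>

lemma emb_genX: "emb f r genX = genX"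
  by (simp add: genX_def emb_const)

lemma aut_extends_iff:
  fixes \<alpha> \<beta> :: "'a::field"
  assumes deg: "degree (r * f) \<ge> 1" and \<omega>: "weyl_hom (r * f) (r * f) \<omega>" and \<alpha>: "\<alpha> \<noteq> 0"
    and g: "pcompose (r * f) [:\<beta>, \<alpha>:] = smult (\<alpha> ^ degree (r * f)) (r * f)"
    and \<omega>X: "\<omega> genX = [:[:\<beta>, \<alpha>:]:]"
    and \<omega>Y: "\<omega> genY = smult [:\<alpha> ^ (degree (r * f) - 1):] (genY + [:q:])"
  shows "(\<exists>\<phi>. is_aut f \<phi> \<and> (\<forall>a. \<phi> (emb f r a) = emb f r (\<omega> a)))
    \<longleftrightarrow> (pcompose f [:\<beta>, \<alpha>:] = smult (\<alpha> ^ degree f) f \<and> r dvd q)"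
proof -
  have rf: "r * f \<noteq> 0" using deg by auto
  define c where "c = \<alpha> ^ (degree (r * f) - 1)"
  have c0: "c \<noteq> 0" using \<alpha> by (simp add: c_def)
  have \<omega>Y': "emb f r (\<omega> genY) = smult [:c:] (wmul f genY [:r:] + [:q:])"
    unfolding \<omega>Y c_def[symmetric] weyl_hom_scale[OF weyl_hom_emb] weyl_hom_add[OF weyl_hom_emb]
    by (simp add: emb_const emb_genY wmul_genY_const)
  show ?thesis
  proof
    assume "\<exists>\<phi>. is_aut f \<phi> \<and> (\<forall>a. \<phi> (emb f r a) = emb f r (\<omega> a))"
    then obtain \<phi> where \<phi>: "weyl_hom f f \<phi>" "\<And>a. \<phi> (emb f r a) = emb f r (\<omega> a)"
      by (auto simp: is_aut_iff)
    have X: "\<phi> genX = [:[:\<beta>, \<alpha>:]:]"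
      using \<phi>(2)[of genX] by (simp add: emb_genX \<omega>X emb_const)
    have "\<phi> (wmul f genY [:r:]) = smult [:c:] (wmul f genY [:r:] + [:q:])"
      using \<phi>(2)[of genY] \<omega>Y' by (simp add: emb_genY wmul_genY_const)
    from extension_conditions[OF \<alpha> rf c0 g \<phi>(1) X this]
    show "pcompose f [:\<beta>, \<alpha>:] = smult (\<alpha> ^ degree f) f \<and> r dvd q" by blast
  next
    assume R: "pcompose f [:\<beta>, \<alpha>:] = smult (\<alpha> ^ degree f) f \<and> r dvd q"
    then have f: "pcompose f [:\<beta>, \<alpha>:] = smult (\<alpha> ^ degree f) f" by simp
    \<comment> \<open>The quotient of \<open>q\<close> by \<open>r\<close> becomes the shift of the
      extension: c'(y + t) times r(\<alpha>x+\<beta>) has to reproduce c(y r + q), where c' =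
      \<open>\<alpha> ^ degree f / \<alpha>\<close>.\<close>
    obtain t where t: "q = r * t" using R by (auto elim: dvdE)
    have r: "pcompose r [:\<beta>, \<alpha>:] = smult (\<alpha> ^ degree r) r"
      by (rule pcompose_affine_cofactor[OF \<alpha> _ _ f]) (use rf g in \<open>simp_all add: mult.commute\<close>)
    obtain \<phi> where \<phi>: "is_aut f \<phi>" "\<phi> genX = [:[:\<beta>, \<alpha>:]:]"
      "\<phi> genY = smult [:\<alpha> ^ degree f / \<alpha>:] (genY + [:t:])"
      using affine_aut_exists[OF \<alpha> f] by blast
    have hom: "weyl_hom f f \<phi>" using \<phi>(1) by (simp add: is_aut_iff)
    \<comment> \<open>Since \<open>g\<close> is nonconstant, the truncated exponent is a genuine
      division by \<alpha>; the result splits into the factors from \<phi>(y) and from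
      r(\<alpha>x+\<beta>).\<close>
    have "c = \<alpha> ^ degree (r * f) / \<alpha>"
      using \<alpha> deg by (simp add: c_def power_diff)
    then have c_eq: "c = (\<alpha> ^ degree f / \<alpha>) * \<alpha> ^ degree r"
      using rf by (simp add: degree_mult_eq power_add)
    \<comment> \<open>Both composites are homomorphisms from \<open>A_g\<close> to
      \<open>A_f\<close>, so agreement on the generators suffices.\<close>
    have "(\<lambda>a. \<phi> (emb f r a)) = (\<lambda>a. emb f r (\<omega> a))"
    proof (rule weyl_hom_eqI[OF weyl_hom_compose[OF weyl_hom_emb hom]
          weyl_hom_compose[OF \<omega> weyl_hom_emb]])
      show "\<phi> (emb f r genX) = emb f r (\<omega> genX)"
        by (simp add: emb_genX \<phi> \<omega>X emb_const)
      have "\<phi> (emb f r genY) = wmul f (\<phi> genY) (\<phi> [:r:])"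
        by (simp add: emb_genY wmul_genY_const flip: weyl_hom_wmul[OF hom])
      also have "\<dots> = smult [:c:] (wmul f genY [:r:] + [:q:])"
        by (simp add: weyl_hom_const[OF hom \<phi>(2)] r \<phi>(3))
          (simp add: genY_pCons wmul_genY_const[unfolded genY_pCons] wmul_linear_const c_eq t
            pderiv_smult smult_add_right algebra_simps)
      finally show "\<phi> (emb f r genY) = emb f r (\<omega> genY)"
        by (simp only: \<omega>Y')
    qed
    then show "\<exists>\<phi>. is_aut f \<phi> \<and> (\<forall>a. \<phi> (emb f r a) = emb f r (\<omega> a))"
      using \<phi>(1) by (auto simp: fun_eq_iff)
  qed
qed

theorem theorem8p16:
  fixes f g r q :: "'a::field poly" and \<alpha> \<beta> :: 'a
    and \<omega> \<psi> :: "'a poly poly \<Rightarrow> 'a poly poly"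
  assumes f_nz: "f \<noteq> 0" and deg_g: "degree g \<ge> 1" and g_eq: "g = r * f"
  shows
    "((is_aut g \<omega> \<and> \<alpha> \<noteq> 0
       \<and> pcompose g [:\<beta>, \<alpha>:] = smult (\<alpha> ^ degree g) g
       \<and> \<omega> genX = [:[:\<beta>, \<alpha>:]:]
       \<and> \<omega> genY = smult [:\<alpha> ^ (degree g - 1):] (genY + [:q:]))
     \<longrightarrow> ((\<exists>\<phi>. is_aut f \<phi> \<and> (\<forall>a. \<phi> (emb f r a) = emb f r (\<omega> a)))
          \<longleftrightarrow> (pcompose f [:\<beta>, \<alpha>:] = smult (\<alpha> ^ degree f) f \<and> r dvd q)))
     \<and>
    (is_aut f \<psi> \<longrightarrow>
       (\<psi> ` range (emb f r) = range (emb f r)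
          \<longleftrightarrow> (\<exists>c. c \<noteq> 0 \<and> \<psi> [:g:] = smult [:c:] [:g:])))"
proof (intro conjI impI)
  assume "is_aut g \<omega> \<and> \<alpha> \<noteq> 0
       \<and> pcompose g [:\<beta>, \<alpha>:] = smult (\<alpha> ^ degree g) g
       \<and> \<omega> genX = [:[:\<beta>, \<alpha>:]:]
       \<and> \<omega> genY = smult [:\<alpha> ^ (degree g - 1):] (genY + [:q:])"
  then show "(\<exists>\<phi>. is_aut f \<phi> \<and> (\<forall>a. \<phi> (emb f r a) = emb f r (\<omega> a)))
          \<longleftrightarrow> (pcompose f [:\<beta>, \<alpha>:] = smult (\<alpha> ^ degree f) f \<and> r dvd q)"
    unfolding g_eq by (intro aut_extends_iff) (use deg_g g_eq in \<open>auto simp: is_aut_iff\<close>)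
next
  assume "is_aut f \<psi>"
  then show "\<psi> ` range (emb f r) = range (emb f r)
          \<longleftrightarrow> (\<exists>c. c \<noteq> 0 \<and> \<psi> [:g:] = smult [:c:] [:g:])"
    unfolding g_eq by (rule aut_preserves_emb_iff) (use deg_g g_eq in simp)
qed

end
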